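(* Let $d\ge 3$ and $N\ge 2$ be integers. For $\varphi\in H^1(\mathbb R^d)$ put $$M(\varphi)=\int_{\mathbb R^d\times\mathbb R^d}\frac{|\varphi(x)|^2|\varphi(y)|^2}{|x-y|^2}\,dx\,dy,$$ and let $$\mathcal D(d)=\inf_{0\neq\varphi\in C_0^\infty(\mathbb R^d)}\frac{\int_{\mathbb R^d}|\nabla\varphi|^2dx\,\int_{\mathbb R^d}|\varphi|^2dx}{M(\varphi)}.$$ Then $$\mathcal C(d,N)\le\frac{2\,\mathcal D(d)}{N-1}.$$
   Context: Points of $\mathbb R^{dN}$ are written $x=(x_1,\dots,x_N)$ with $x_i\in\mathbb R^d$, and $r_{ij}=|x_i-x_j|$. The constant $\mathcal C(d,N)$ is defined by $$\mathcal C(d,N)=\inf_{0\ne u\in H^{1}(\mathbb R^{dN})}\frac{\int_{\mathbb R^{dN}}|\nabla u|^2\,dx}{\sum_{1\le i<j\le N}\int_{\mathbb R^{dN}}\frac{|u|^2}{r_{ij}^2}\,dx},$$ where $\nabla$ is the full gradient on $\mathbb R^{dN}$ and functions are complex-valued. *)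

theory Defs
  imports "HOL-Analysis.Analysis"
begin

text \<open>All energies, masses and quotients take values in \<^typ>\<open>ennreal\<close>, so that no integral is
  silently set to 0 by non-integrability and an infimum over an empty set would be \<open>\<infinity>\<close>.\<close>

subsection \<open>Test functions\<close>

definition pderiv_dir :: "'a::euclidean_space \<Rightarrow> ('a \<Rightarrow> complex) \<Rightarrow> 'a \<Rightarrow> complex" where
  "pderiv_dir b f = (\<lambda>x. frechet_derivative f (at x) b)"

fun Ck :: "nat \<Rightarrow> ('a::euclidean_space \<Rightarrow> complex) \<Rightarrow> bool" where
  "Ck 0 f \<longleftrightarrow> continuous_on UNIV f"
| "Ck (Suc k) f \<longleftrightarrow> (\<forall>x. f differentiable (at x)) \<and> (\<forall>b\<in>Basis. Ck k (pderiv_dir b f))"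

definition test_functions :: "('a::euclidean_space \<Rightarrow> complex) set" where
  "test_functions = {f. (\<forall>k. Ck k f) \<and> compact (closure {x. f x \<noteq> 0})}"

subsection \<open>The Sobolev space \<open>H\<^sup>1\<close>\<close>

text \<open>Elements of \<open>L\<^sup>2\<close> and \<open>H\<^sup>1\<close> are Borel representatives, not equivalence classes.\<close>

definition L2 :: "('a::euclidean_space \<Rightarrow> complex) set" where
  "L2 = {u. u \<in> borel_measurable lborel \<and> (\<integral>\<^sup>+x. ennreal ((norm (u x))\<^sup>2) \<partial>lborel) < \<infinity>}"

text \<open>\<open>G b\<close> is the weak partial derivative of \<open>u\<close> in the coordinate direction \<open>b\<close>. An
  \<open>L\<^sup>2\<close> function has at most one weak gradient up to null sets.\<close>

definition weak_gradient ::
    "('a::euclidean_space \<Rightarrow> complex) \<Rightarrow> ('a \<Rightarrow> 'a \<Rightarrow> complex) \<Rightarrow> bool" where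
  "weak_gradient u G \<longleftrightarrow> (\<forall>b\<in>Basis. G b \<in> L2 \<and>
     (\<forall>\<psi>\<in>test_functions.
        (LINT x|lborel. u x * pderiv_dir b \<psi> x) = - (LINT x|lborel. G b x * \<psi> x)))"

definition H1 :: "('a::euclidean_space \<Rightarrow> complex) set" where
  "H1 = {u \<in> L2. \<exists>G. weak_gradient u G}"

definition energy :: "('a::euclidean_space \<Rightarrow> 'a \<Rightarrow> complex) \<Rightarrow> ennreal" where
  "energy G = (\<integral>\<^sup>+x. ennreal (\<Sum>b\<in>Basis. (norm (G b x))\<^sup>2) \<partial>lborel)"

subsection \<open>The constants\<close>

text \<open>The space \<open>\<real>\<^sup>d\<^sup>N\<close> is \<open>(real^'d)^'n\<close> with \<open>d = CARD('d)\<close> and \<open>N = CARD('n)\<close>; the linear order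
  on \<open>'n\<close> only serves to enumerate the pairs \<open>i < j\<close>. On the null sets \<open>x $ i = x $ j\<close> (and
  \<open>x = y\<close> in \<open>pair_integral\<close>) the weight is 0, because division by zero gives zero.\<close>

definition pair_hardy_sum :: "((real^'d, 'n::{finite,linorder}) vec \<Rightarrow> complex) \<Rightarrow> ennreal" where
  "pair_hardy_sum u = (\<Sum>(i, j)\<in>{(i, j). i < j}.
     \<integral>\<^sup>+x. ennreal ((norm (u x))\<^sup>2 / (dist (x $ i) (x $ j))\<^sup>2) \<partial>lborel)"

text \<open>The quotient is independent of the choice of \<open>G\<close>, by almost everywhere uniqueness of the weak
  gradient, so this is the infimum over all \<open>u \<in> H1\<close> which do not vanish almost everywhere.\<close>

definition hardy_const :: "'d::finite itself \<Rightarrow> 'n::{finite,linorder} itself \<Rightarrow> ennreal" where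
  "hardy_const _ _ =
     (INF (u, G)\<in>{(u :: (real^'d, 'n) vec \<Rightarrow> complex, G).
          u \<in> H1 \<and> weak_gradient u G \<and> \<not> (AE x in lborel. u x = 0)}.
        energy G / pair_hardy_sum u)"

definition pair_integral :: "(real^'d \<Rightarrow> complex) \<Rightarrow> ennreal" where
  "pair_integral \<phi> = (\<integral>\<^sup>+(x, y).
     ennreal ((norm (\<phi> x))\<^sup>2 * (norm (\<phi> y))\<^sup>2 / (norm (x - y))\<^sup>2) \<partial>lborel)"

definition D_const :: "'d::finite itself \<Rightarrow> ennreal" where
  "D_const _ =
     (INF \<phi>\<in>{\<phi> :: real^'d \<Rightarrow> complex. \<phi> \<in> test_functions \<and> \<phi> \<noteq> (\<lambda>_. 0)}.
        energy (\<lambda>b. pderiv_dir b \<phi>) * (\<integral>\<^sup>+x. ennreal ((norm (\<phi> x))\<^sup>2) \<partial>lborel)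
          / pair_integral \<phi>)"

end

theory Submission
  imports Defs
begin

text \<open>
  The bound comes from the product trial functions \<open>u(x) = \<phi>(x\<^sub>1) \<dots> \<phi>(x\<^sub>N)\<close>, where \<open>\<phi> \<noteq> 0\<close> is a test
  function on \<open>\<real>\<^sup>d\<close>. Write \<open>E\<close> for the energy of \<open>\<phi>\<close>, \<open>m\<close> for the integral of \<open>|\<phi>|\<^sup>2\<close>, and \<open>M\<close> for
  its pair integral. By Tonelli's theorem the energy of \<open>u\<close> is \<open>N E m\<^bsup>N-1\<^esup>\<close>
  (\<open>energy_tensor_power\<close>), and each of the \<open>N (N - 1) / 2\<close> pairs contributes \<open>M m\<^bsup>N-2\<^esup>\<close> to the
  denominator (\<open>pair_hardy_sum_tensor_power\<close>). Hence the quotient of \<open>u\<close> is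
  \<open>2 E m / ((N - 1) M)\<close> (\<open>quotient_identity\<close>), and it remains to take the infimum over \<open>\<phi>\<close>.

  Two facts make this rigorous. Lebesgue measure on a Cartesian power is the image of the product
  of the Lebesgue measures on the factors (\<open>lborel_vec\<close>), so that Tonelli's theorem for
  finite products applies. And \<open>u\<close> is admissible: for a compactly supported \<open>C\<^sup>1\<close> function the
  classical gradient is a weak gradient (\<open>weak_gradient_pderiv_dir\<close>).
\<close>

section \<open>Lebesgue measure on finite Cartesian powers\<close>

lemma prod_Basis_vec:
  "(\<Prod>b\<in>(Basis :: ('a::euclidean_space ^ 'n::finite) set). f b) = (\<Prod>i\<in>UNIV. \<Prod>b\<in>Basis. f (axis i b))"
proof -
  have "(\<Prod>b\<in>(\<Union>i::'n. \<Union>u\<in>(Basis::'a set). {axis i u}). f b)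
      = (\<Prod>i\<in>UNIV. \<Prod>b\<in>(\<Union>u\<in>Basis. {axis i u}). f b)"
    by (rule prod.UNION_disjoint) (auto simp: axis_eq_axis)
  also have "\<dots> = (\<Prod>i\<in>UNIV. \<Prod>b\<in>Basis. f (axis i b))"
    by (intro prod.cong refl, subst prod.UNION_disjoint) (auto simp: axis_eq_axis)
  finally show ?thesis by (simp add: Basis_vec_def)
qed

lemma sum_Basis_vec:
  "(\<Sum>b\<in>(Basis :: ('a::euclidean_space ^ 'n::finite) set). f b) = (\<Sum>i\<in>UNIV. \<Sum>b\<in>Basis. f (axis i b))"
proof -
  have "(\<Sum>b\<in>(\<Union>i::'n. \<Union>u\<in>(Basis::'a set). {axis i u}). f b)
      = (\<Sum>i\<in>UNIV. \<Sum>b\<in>(\<Union>u\<in>Basis. {axis i u}). f b)"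
    by (rule sum.UNION_disjoint) (auto simp: axis_eq_axis)
  also have "\<dots> = (\<Sum>i\<in>UNIV. \<Sum>b\<in>Basis. f (axis i b))"
    by (intro sum.cong refl, subst sum.UNION_disjoint) (auto simp: axis_eq_axis)
  finally show ?thesis by (simp add: Basis_vec_def)
qed

lemma borel_measurable_vec_lambda [measurable]:
  "(vec_lambda :: ('n::finite \<Rightarrow> 'a::euclidean_space) \<Rightarrow> _) \<in> borel_measurable (Pi\<^sub>M UNIV (\<lambda>_. lborel))"
proof (subst borel_measurable_euclidean_space, intro ballI)
  fix b :: "'a ^ 'n" assume "b \<in> Basis"
  then obtain i c where b: "b = axis i c" "c \<in> Basis"
    by (auto simp: Basis_vec_def)
  show "(\<lambda>f. vec_lambda f \<bullet> b) \<in> borel_measurable (Pi\<^sub>M UNIV (\<lambda>_::'n. lborel :: 'a measure))"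
    unfolding b by (simp add: inner_axis) measurable
qed

lemma lborel_vec:
  "(lborel :: ('a::euclidean_space ^ 'n::finite) measure) = distr (Pi\<^sub>M UNIV (\<lambda>_. lborel)) borel vec_lambda"
proof (rule lborel_eqI)
  fix l u :: "'a ^ 'n" assume le: "\<And>b. b \<in> Basis \<Longrightarrow> l \<bullet> b \<le> u \<bullet> b"
  have le': "l $ i \<bullet> b \<le> u $ i \<bullet> b" if "b \<in> Basis" for i b
    using le[of "axis i b"] that by (simp add: inner_axis)
  interpret product_sigma_finite "\<lambda>_::'n. lborel :: 'a measure" ..
  have "vec_lambda -` box l u \<inter> space (Pi\<^sub>M UNIV (\<lambda>_::'n. lborel :: 'a measure))
      = (\<Pi>\<^sub>E i\<in>UNIV. box (l $ i) (u $ i))"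
    by (auto simp: mem_box Basis_vec_def inner_axis space_PiM PiE_iff)
  then have "emeasure (distr (Pi\<^sub>M UNIV (\<lambda>_. lborel)) borel vec_lambda) (box l u)
      = (\<Prod>i\<in>UNIV. emeasure lborel (box (l $ i) (u $ i)))"
    by (simp add: emeasure_distr emeasure_PiM)
  also have "\<dots> = (\<Prod>i\<in>UNIV. ennreal (\<Prod>b\<in>Basis. (u $ i - l $ i) \<bullet> b))"
    by (intro prod.cong refl emeasure_lborel_box le')
  also have "\<dots> = ennreal (\<Prod>i\<in>UNIV. \<Prod>b\<in>Basis. (u $ i - l $ i) \<bullet> b)"
    by (intro prod_ennreal prod_nonneg) (auto simp: inner_diff_left le')
  also have "\<dots> = ennreal (\<Prod>b\<in>Basis. (u - l) \<bullet> b)"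
    by (simp add: prod_Basis_vec inner_axis)
  finally show "emeasure (distr (Pi\<^sub>M UNIV (\<lambda>_. lborel)) borel vec_lambda) (box l u)
      = ennreal (\<Prod>b\<in>Basis. (u - l) \<bullet> b)" .
qed simp

lemma nn_integral_lborel_vec:
  fixes f :: "'a::euclidean_space ^ 'n::finite \<Rightarrow> ennreal"
  assumes [measurable]: "f \<in> borel_measurable borel"
  shows "(\<integral>\<^sup>+x. f x \<partial>lborel) = (\<integral>\<^sup>+x. f (vec_lambda x) \<partial>Pi\<^sub>M UNIV (\<lambda>_. lborel))"
  by (subst lborel_vec) (simp add: nn_integral_distr)

lemma borel_measurable_vec_nth' [measurable]:
  "(\<lambda>x :: 'a::euclidean_space ^ 'n::finite. x $ i) \<in> borel_measurable borel"
  by (intro borel_measurable_continuous_onI continuous_intros)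

lemma nn_integral_vec_prod:
  fixes f :: "'n::finite \<Rightarrow> 'a::euclidean_space \<Rightarrow> ennreal"
  assumes [measurable]: "\<And>i. f i \<in> borel_measurable borel"
  shows "(\<integral>\<^sup>+x. (\<Prod>i\<in>UNIV. f i (x $ i)) \<partial>lborel) = (\<Prod>i\<in>UNIV. \<integral>\<^sup>+y. f i y \<partial>lborel)"
proof -
  interpret product_sigma_finite "\<lambda>_::'n. lborel :: 'a measure" ..
  show ?thesis
    by (subst nn_integral_lborel_vec) (simp_all add: product_nn_integral_prod)
qed

text \<open>Two coordinates are coupled by \<open>F\<close>; the remaining ones separate.\<close>

lemma nn_integral_vec_pair:
  fixes F :: "'a::euclidean_space \<Rightarrow> 'a \<Rightarrow> ennreal" and i j :: "'n::finite"
  assumes ij: "i \<noteq> j"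
    and [measurable]: "case_prod F \<in> borel_measurable (borel \<Otimes>\<^sub>M borel)" "g \<in> borel_measurable borel"
  shows "(\<integral>\<^sup>+x. F (x $ i) (x $ j) * (\<Prod>k\<in>UNIV - {i, j}. g (x $ k)) \<partial>lborel)
    = (\<integral>\<^sup>+(x, y). F x y \<partial>lborel) * (\<integral>\<^sup>+y. g y \<partial>lborel) ^ (CARD('n) - 2)"
proof -
  interpret product_sigma_finite "\<lambda>_::'n. lborel :: 'a measure" ..
  define K where "K = UNIV - {i, j}"
  have K: "i \<notin> K" "j \<notin> insert i K" "finite K" "UNIV = insert j (insert i K)"
    using ij by (auto simp: K_def)
  have Fm [measurable]: "(\<lambda>w. F (p w) (q w)) \<in> borel_measurable M"
    if "p \<in> borel_measurable M" "q \<in> borel_measurable M" for p q and M :: "'z measure"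
    using measurable_compose[OF measurable_Pair[OF that] assms(2)] by simp
  have card: "card K = CARD('n) - 2"
    using ij by (simp add: K_def card_Diff_subset)
  let ?f = "\<lambda>x. F (x i) (x j) * (\<Prod>k\<in>K. g (x k))"
  have m: "?f \<in> borel_measurable (Pi\<^sub>M (insert j (insert i K)) (\<lambda>_. lborel))"
    by measurable
  have m': "(\<lambda>x. \<integral>\<^sup>+z. F (x i) z * (\<Prod>k\<in>K. g (x k)) \<partial>lborel)
     \<in> borel_measurable (Pi\<^sub>M (insert i K) (\<lambda>_. lborel))"
    by measurable
  have "(\<integral>\<^sup>+x. F (x $ i) (x $ j) * (\<Prod>k\<in>K. g (x $ k)) \<partial>lborel)
      = (\<integral>\<^sup>+x. ?f x \<partial>Pi\<^sub>M (insert j (insert i K)) (\<lambda>_. lborel))"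
    by (subst nn_integral_lborel_vec) (simp_all add: K(4)[symmetric])
  also have "\<dots> = (\<integral>\<^sup>+x. \<integral>\<^sup>+z. F (x i) z * (\<Prod>k\<in>K. g (x k)) \<partial>lborel \<partial>Pi\<^sub>M (insert i K) (\<lambda>_. lborel))"
    using ij K by (subst product_nn_integral_insert[OF _ _ m])
      (auto intro!: nn_integral_cong arg_cong2[where f="(*)"] prod.cong)
  also have "\<dots> = (\<integral>\<^sup>+x. \<integral>\<^sup>+y. \<integral>\<^sup>+z. F y z * (\<Prod>k\<in>K. g (x k)) \<partial>lborel \<partial>lborel \<partial>Pi\<^sub>M K (\<lambda>_. lborel))"
    using ij K by (subst product_nn_integral_insert[OF _ _ m'])
      (auto intro!: nn_integral_cong arg_cong2[where f="(*)"] prod.cong)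
  also have "\<dots> = (\<integral>\<^sup>+x. (\<integral>\<^sup>+y. \<integral>\<^sup>+z. F y z \<partial>lborel \<partial>lborel) * (\<Prod>k\<in>K. g (x k)) \<partial>Pi\<^sub>M K (\<lambda>_. lborel))"
    by (intro nn_integral_cong) (simp add: nn_integral_multc)
  also have "\<dots> = (\<integral>\<^sup>+y. \<integral>\<^sup>+z. F y z \<partial>lborel \<partial>lborel) * (\<integral>\<^sup>+y. g y \<partial>lborel) ^ card K"
    using K(3) by (simp add: nn_integral_cmult product_nn_integral_prod[where f = "\<lambda>_. g"])
  also have "(\<integral>\<^sup>+y. \<integral>\<^sup>+z. F y z \<partial>lborel \<partial>lborel) = (\<integral>\<^sup>+(x, y). F x y \<partial>lborel)"
    by (subst lborel_prod[symmetric], subst lborel.nn_integral_fst[symmetric]) simp_all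
  finally show ?thesis unfolding card by (simp only: K_def)
qed

section \<open>Integration by parts for compactly supported functions\<close>

lemma integrable_continuous_bounded_support:
  fixes f :: "'a::euclidean_space \<Rightarrow> 'b::{banach, second_countable_topology}"
  assumes "continuous_on UNIV f" and R: "\<And>x. R < norm x \<Longrightarrow> f x = 0"
  shows "integrable lborel f"
proof -
  have "integrable lborel (\<lambda>x. indicator (cball 0 R) x *\<^sub>R f x)"
    by (rule borel_integrable_compact) (auto intro: continuous_on_subset assms)
  also have "(\<lambda>x. indicator (cball 0 R) x *\<^sub>R f x) = f"
    using R by (force simp: indicator_def not_le)
  finally show ?thesis .
qed

lemma L2_continuous_bounded_support:
  assumes "continuous_on UNIV u" and R: "\<And>x. R < norm x \<Longrightarrow> u x = 0"
  shows "u \<in> L2"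
proof -
  have "integrable lborel (\<lambda>x. (norm (u x))\<^sup>2)"
    by (rule integrable_continuous_bounded_support[where R = R]) (auto intro!: continuous_intros assms simp: R)
  then have "(\<integral>\<^sup>+x. ennreal ((norm (u x))\<^sup>2) \<partial>lborel) < \<infinity>"
    by (simp add: integrable_iff_bounded)
  with assms(1) show ?thesis
    by (auto simp: L2_def intro: borel_measurable_continuous_onI)
qed

lemma Ck_1_continuous: "Ck (Suc 0) f \<Longrightarrow> continuous_on UNIV f"
  by (auto intro!: differentiable_imp_continuous_on simp: differentiable_on_def intro: differentiable_at_withinI)

lemma pderiv_dir_eq: "(f has_derivative D) (at x) \<Longrightarrow> pderiv_dir b f x = D b"
  unfolding pderiv_dir_def by (metis frechet_derivative_at)

lemma pderiv_dir_bounded_support: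
  assumes "\<And>x. R < norm x \<Longrightarrow> f x = 0" and "R < norm x"
  shows "pderiv_dir b f x = 0"
proof -
  have "open {x::'a. R < norm x}"
    by (intro open_Collect_less continuous_intros)
  then have "(f has_derivative (\<lambda>_. 0)) (at x)"
    using assms by (intro has_derivative_transform_within_open[OF has_derivative_const[of 0]]) auto
  then show ?thesis by (simp add: pderiv_dir_eq)
qed

text \<open>By translation invariance, every difference quotient of \<open>f\<close> has integral 0. The difference
  quotients along \<open>b\<close> converge to the derivative and, by the mean value inequality, are bounded by
  a constant on a fixed ball outside which they vanish, so dominated convergence applies.\<close>

lemma integral_pderiv_dir_eq_0:
  fixes f :: "'a::euclidean_space \<Rightarrow> complex"
  assumes diff: "\<And>x. f differentiable (at x)" and cont: "continuous_on UNIV (pderiv_dir b f)"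
    and b: "b \<in> Basis" and R: "\<And>x. R < norm x \<Longrightarrow> f x = 0"
  shows "(LINT x|lborel. pderiv_dir b f x) = 0"
proof -
  have contf: "continuous_on UNIV f" using diff
    by (auto intro!: differentiable_imp_continuous_on simp: differentiable_on_def intro: differentiable_at_withinI)
  have [measurable]: "f \<in> borel_measurable borel" "pderiv_dir b f \<in> borel_measurable borel"
    by (intro borel_measurable_continuous_onI contf cont)+
  have int: "integrable lborel f"
    by (rule integrable_continuous_bounded_support[OF contf R])
  have line: "((\<lambda>t. f (x + t *\<^sub>R b)) has_vector_derivative pderiv_dir b f (x + t *\<^sub>R b)) (at t within S)" for x t S
  proof -
    have f: "(f has_derivative frechet_derivative f (at (x + t *\<^sub>R b))) (at (x + t *\<^sub>R b))"
      using diff frechet_derivative_works by blast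
    have l: "((\<lambda>t. x + t *\<^sub>R b) has_derivative (\<lambda>s. s *\<^sub>R b)) (at t within S)"
      by (auto intro!: derivative_eq_intros)
    have "((\<lambda>t. f (x + t *\<^sub>R b)) has_derivative (\<lambda>s. frechet_derivative f (at (x + t *\<^sub>R b)) (s *\<^sub>R b))) (at t within S)"
      using has_derivative_compose[OF l f] .
    moreover have "frechet_derivative f (at (x + t *\<^sub>R b)) (s *\<^sub>R b) = s *\<^sub>R pderiv_dir b f (x + t *\<^sub>R b)" for s
      unfolding pderiv_dir_def
      by (rule linear_scale[OF has_derivative_linear[OF f]])
    ultimately show ?thesis by (simp add: has_vector_derivative_def)
  qed
  have "bounded (pderiv_dir b f ` cball 0 R)"
    by (intro compact_imp_bounded compact_continuous_image continuous_on_subset[OF cont]) auto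
  then obtain C where "0 < C" and "\<forall>x\<in>cball 0 R. norm (pderiv_dir b f x) \<le> C"
    unfolding bounded_pos by blast
  then have C: "norm (pderiv_dir b f x) \<le> C" for x
    using pderiv_dir_bounded_support[of R f x b, OF R] by (cases "x \<in> cball 0 R") (auto simp: not_le)
  define h where "h n = inverse (real (Suc n))" for n
  have h: "0 < h n" "h n \<le> 1" for n
    by (auto simp: h_def divide_simps)
  define q where "q n x = (f (x + h n *\<^sub>R b) - f x) /\<^sub>R h n" for n x
  have [measurable]: "q n \<in> borel_measurable borel" for n
    unfolding q_def by measurable
  have shift: "integrable lborel (\<lambda>x. f (x + c))" "(LINT x|lborel. f (x + c)) = (LINT x|lborel. f x)" for c
  proof -
    have "integrable (distr lborel borel ((+) c)) f"
      by (simp add: lborel_distr_plus int)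
    then show "integrable lborel (\<lambda>x. f (x + c))"
      by (simp add: integrable_distr_eq add.commute)
    have "(LINT x|lborel. f x) = (LINT x|distr lborel borel ((+) c). f x)"
      by (simp add: lborel_distr_plus)
    then show "(LINT x|lborel. f (x + c)) = (LINT x|lborel. f x)"
      by (simp add: integral_distr add.commute)
  qed
  have "(LINT x|lborel. q n x) = 0" for n
    unfolding q_def using shift int by simp
  moreover have "(\<lambda>n. LINT x|lborel. q n x) \<longlonglongrightarrow> (LINT x|lborel. pderiv_dir b f x)"
  proof (rule integral_dominated_convergence[where w = "\<lambda>x. C * indicator (cball 0 (R + 1)) x"])
    show "integrable lborel (\<lambda>x::'a. C * indicator (cball 0 (R + 1)) x)"
      by (intro integrable_mult_right integrable_real_indicator) (auto simp: emeasure_lborel_cball_finite[simplified])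
    show "AE x in lborel. (\<lambda>n. q n x) \<longlonglongrightarrow> pderiv_dir b f x"
    proof (rule AE_I2)
      fix x
      have "((\<lambda>t. (f (x + t *\<^sub>R b) - f x) /\<^sub>R t) \<longlongrightarrow> pderiv_dir b f x) (at 0)"
      proof (rule LIM_zero_cancel, rule tendsto_norm_zero_cancel, rule Lim_transform_eventually)
        show "(\<lambda>t. norm (f (x + (0 + t) *\<^sub>R b) - f (x + 0 *\<^sub>R b) - t *\<^sub>R pderiv_dir b f x) / norm t) \<midarrow>0\<rightarrow> 0"
          using line[of x 0 UNIV] by (simp add: has_vector_derivative_def has_derivative_at)
        have "norm (f (x + (0 + t) *\<^sub>R b) - f (x + 0 *\<^sub>R b) - t *\<^sub>R pderiv_dir b f x) / norm t
            = norm ((f (x + t *\<^sub>R b) - f x) /\<^sub>R t - pderiv_dir b f x)" if "t \<noteq> 0" for t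
        proof -
          have "(f (x + t *\<^sub>R b) - f x) /\<^sub>R t - pderiv_dir b f x
              = (f (x + t *\<^sub>R b) - f x - t *\<^sub>R pderiv_dir b f x) /\<^sub>R t"
            using that by (simp add: scaleR_right_diff_distrib)
          then show ?thesis by (simp add: divide_inverse mult.commute)
        qed
        then show "\<forall>\<^sub>F t in at 0. norm (f (x + (0 + t) *\<^sub>R b) - f (x + 0 *\<^sub>R b) - t *\<^sub>R pderiv_dir b f x) / norm t
            = norm ((f (x + t *\<^sub>R b) - f x) /\<^sub>R t - pderiv_dir b f x)"
          by (simp add: eventually_at_filter)
      qed
      moreover have "filterlim h (at 0) sequentially"
        unfolding filterlim_at h_def using LIMSEQ_inverse_real_of_nat by auto
      ultimately show "(\<lambda>n. q n x) \<longlonglongrightarrow> pderiv_dir b f x"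
        unfolding q_def by (rule filterlim_compose)
    qed
    show "AE x in lborel. norm (q n x) \<le> C * indicator (cball 0 (R + 1)) x" for n
    proof (rule AE_I2)
      fix x
      show "norm (q n x) \<le> C * indicator (cball 0 (R + 1)) x"
      proof (cases "x \<in> cball 0 (R + 1)")
        case True
        have "norm (f (x + h n *\<^sub>R b) - f (x + 0 *\<^sub>R b)) \<le> C * norm (h n - 0)"
        proof (rule differentiable_bound[where S = UNIV and f' = "\<lambda>t s. s *\<^sub>R pderiv_dir b f (x + t *\<^sub>R b)"])
          show "((\<lambda>t. f (x + t *\<^sub>R b)) has_derivative (\<lambda>s. s *\<^sub>R pderiv_dir b f (x + t *\<^sub>R b))) (at t)" for t
            using line by (simp add: has_vector_derivative_def)
          show "onorm (\<lambda>s. s *\<^sub>R pderiv_dir b f (x + t *\<^sub>R b)) \<le> C" for t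
            using C by (intro onorm_le) (simp add: mult.commute[of C] mult_left_mono)
        qed auto
        moreover have "norm (q n x) = norm (f (x + h n *\<^sub>R b) - f x) / h n"
          using h[of n] by (simp add: q_def divide_inverse mult.commute)
        ultimately show ?thesis
          using h[of n] True by (simp add: divide_le_eq)
      next
        case False
        then have x: "R + 1 < norm x" by simp
        have "norm x \<le> norm (x + h n *\<^sub>R b) + norm (h n *\<^sub>R b)"
          by (metis add_diff_cancel norm_triangle_ineq4)
        also have "norm (h n *\<^sub>R b) \<le> 1"
          using h[of n] b by simp
        finally have "R < norm (x + h n *\<^sub>R b)" using x by simp
        then show ?thesis using x False by (simp add: q_def R)
      qed
    qed
  qed auto
  ultimately show ?thesis
    by (simp add: LIMSEQ_const_iff)
qed

text \<open>Integration by parts: the derivative of \<open>u \<psi>\<close> has integral 0 for every test function \<open>\<psi>\<close>.\<close>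

lemma weak_gradient_pderiv_dir:
  fixes u :: "'a::euclidean_space \<Rightarrow> complex"
  assumes u: "Ck (Suc 0) u" and R: "\<And>x. R < norm x \<Longrightarrow> u x = 0"
  shows "weak_gradient u (\<lambda>b. pderiv_dir b u)"
  unfolding weak_gradient_def
proof (intro ballI conjI)
  fix b :: 'a assume b: "b \<in> Basis"
  have cu: "continuous_on UNIV u" "continuous_on UNIV (pderiv_dir b u)"
    using u b Ck_1_continuous[OF u] by auto
  show "pderiv_dir b u \<in> L2"
    using cu(2) pderiv_dir_bounded_support[OF R] by (rule L2_continuous_bounded_support)
  fix \<psi> :: "'a \<Rightarrow> complex" assume "\<psi> \<in> test_functions"
  then have \<psi>: "Ck (Suc 0) \<psi>"
    unfolding test_functions_def by blast
  have c\<psi>: "continuous_on UNIV \<psi>" "continuous_on UNIV (pderiv_dir b \<psi>)"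
    using \<psi> b Ck_1_continuous[OF \<psi>] by auto
  have der: "((\<lambda>x. u x * \<psi> x) has_derivative (\<lambda>y. u x * frechet_derivative \<psi> (at x) y + frechet_derivative u (at x) y * \<psi> x)) (at x)" for x
    using u \<psi> by (intro has_derivative_mult) (auto simp: frechet_derivative_works[symmetric])
  have eq: "pderiv_dir b (\<lambda>x. u x * \<psi> x) = (\<lambda>x. u x * pderiv_dir b \<psi> x + pderiv_dir b u x * \<psi> x)"
    using pderiv_dir_eq[OF der] by (auto simp: pderiv_dir_def)
  have "(LINT x|lborel. pderiv_dir b (\<lambda>x. u x * \<psi> x) x) = 0"
  proof (rule integral_pderiv_dir_eq_0)
    show "(\<lambda>x. u x * \<psi> x) differentiable (at x)" for x
      using der by (auto simp: differentiable_def)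
    show "continuous_on UNIV (pderiv_dir b (\<lambda>x. u x * \<psi> x))"
      unfolding eq by (intro continuous_intros cu c\<psi>)
    show "R < norm x \<Longrightarrow> u x * \<psi> x = 0" for x by (simp add: R)
  qed (rule b)
  moreover have "integrable lborel (\<lambda>x. u x * pderiv_dir b \<psi> x)" "integrable lborel (\<lambda>x. pderiv_dir b u x * \<psi> x)"
    by (rule integrable_continuous_bounded_support[where R = R];
        auto intro!: continuous_intros cu c\<psi> simp: R pderiv_dir_bounded_support[OF R])+
  ultimately show "(LINT x|lborel. u x * pderiv_dir b \<psi> x) = - (LINT x|lborel. pderiv_dir b u x * \<psi> x)"
    by (simp add: eq eq_neg_iff_add_eq_0)
qed


section \<open>Product trial functions\<close>

text \<open>The \<open>N\<close>-fold tensor power \<open>x \<mapsto> \<phi>(x\<^sub>1) \<dots> \<phi>(x\<^sub>N)\<close>.\<close>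

definition tensor_power :: "('a \<Rightarrow> complex) \<Rightarrow> 'a ^ 'n::finite \<Rightarrow> complex" where
  "tensor_power \<phi> x = (\<Prod>i\<in>UNIV. \<phi> (x $ i))"

lemma has_derivative_tensor_power:
  fixes \<phi> :: "'a::euclidean_space \<Rightarrow> complex" and x :: "'a ^ 'n::finite"
  assumes "\<And>y. \<phi> differentiable (at y)"
  shows "(tensor_power \<phi> has_derivative
    (\<lambda>y. \<Sum>i\<in>UNIV. frechet_derivative \<phi> (at (x $ i)) (y $ i) * (\<Prod>j\<in>UNIV - {i}. \<phi> (x $ j)))) (at x)"
proof -
  have "((\<lambda>x :: 'a ^ 'n. \<phi> (x $ i)) has_derivative (\<lambda>y. frechet_derivative \<phi> (at (x $ i)) (y $ i))) (at x)" for i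
  proof -
    have "((\<lambda>x :: 'a ^ 'n. x $ i) has_derivative (\<lambda>y. y $ i)) (at x)"
      by (rule bounded_linear_imp_has_derivative[OF bounded_linear_vec_nth])
    moreover have "(\<phi> has_derivative frechet_derivative \<phi> (at (x $ i))) (at (x $ i))"
      using assms frechet_derivative_works by blast
    ultimately show ?thesis by (rule has_derivative_compose)
  qed
  then show ?thesis
    unfolding tensor_power_def[abs_def] by (rule has_derivative_prod)
qed

lemma pderiv_dir_tensor_power:
  fixes \<phi> :: "'a::euclidean_space \<Rightarrow> complex" and x :: "'a ^ 'n::finite"
  assumes "\<And>y. \<phi> differentiable (at y)"
  shows "pderiv_dir (axis i b) (tensor_power \<phi>) x = pderiv_dir b \<phi> (x $ i) * (\<Prod>j\<in>UNIV - {i}. \<phi> (x $ j))"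
proof -
  have zero: "frechet_derivative \<phi> (at z) 0 = 0" for z
    using assms frechet_derivative_works has_derivative_linear linear_0 by blast
  have "pderiv_dir (axis i b) (tensor_power \<phi>) x
      = (\<Sum>k\<in>UNIV. frechet_derivative \<phi> (at (x $ k)) (axis i b $ k) * (\<Prod>j\<in>UNIV - {k}. \<phi> (x $ j)))"
    by (rule pderiv_dir_eq[OF has_derivative_tensor_power[OF assms]])
  also have "\<dots> = (\<Sum>k\<in>{i}. frechet_derivative \<phi> (at (x $ k)) (axis i b $ k) * (\<Prod>j\<in>UNIV - {k}. \<phi> (x $ j)))"
    by (intro sum.mono_neutral_right) (auto simp: axis_def zero)
  finally show ?thesis by (simp add: pderiv_dir_def)
qed

lemma Ck_1_tensor_power:
  fixes \<phi> :: "'a::euclidean_space \<Rightarrow> complex"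
  assumes "Ck (Suc 0) \<phi>"
  shows "Ck (Suc 0) (tensor_power \<phi> :: 'a ^ 'n::finite \<Rightarrow> complex)"
proof -
  have d: "\<And>y. \<phi> differentiable (at y)" and c: "\<And>b. b \<in> Basis \<Longrightarrow> continuous_on UNIV (pderiv_dir b \<phi>)"
    using assms by auto
  have comp: "continuous_on UNIV (\<lambda>x :: 'a ^ 'n. g (x $ i))" if "continuous_on UNIV g" for g :: "'a \<Rightarrow> complex" and i
    by (rule continuous_on_compose2[OF that]) (auto intro!: continuous_intros)
  have "continuous_on UNIV (pderiv_dir (axis i b) (tensor_power \<phi> :: 'a ^ 'n \<Rightarrow> complex))" if "b \<in> Basis" for i b
    unfolding pderiv_dir_tensor_power[OF d, abs_def]
    by (intro continuous_intros comp c that Ck_1_continuous assms)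
  moreover have "(tensor_power \<phi> :: 'a ^ 'n \<Rightarrow> complex) differentiable (at x)" for x
    using has_derivative_tensor_power[OF d] by (auto simp: differentiable_def)
  ultimately show ?thesis
    by (auto simp: Basis_vec_def)
qed

lemma tensor_power_bounded_support:
  fixes x :: "'a::euclidean_space ^ 'n::finite"
  assumes R: "\<And>y. R < norm y \<Longrightarrow> \<phi> y = 0" and x: "real CARD('n) * R < norm x"
  shows "tensor_power \<phi> x = 0"
proof -
  have "norm x \<le> (\<Sum>i\<in>UNIV. norm (x $ i))"
    unfolding norm_vec_def by (rule L2_set_le_sum) simp
  with x have "(\<Sum>i\<in>(UNIV :: 'n set). R) < (\<Sum>i\<in>UNIV. norm (x $ i))"
    by simp
  then obtain i where "R < norm (x $ i)"
    by (metis not_le sum_mono)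
  then show ?thesis
    by (auto simp: tensor_power_def intro: R)
qed

lemma continuous_AE_lborel_eq_0:
  fixes f :: "'a::euclidean_space \<Rightarrow> 'b::real_normed_vector"
  assumes "continuous_on UNIV f" and "AE x in lborel. f x = 0"
  shows "f = (\<lambda>_. 0)"
proof -
  have op: "open {x. f x \<noteq> 0}"
    by (intro open_Collect_neq continuous_intros assms)
  then have "{x. f x \<noteq> 0} \<in> null_sets lborel"
    using assms(2) AE_iff_null_sets[of "{x. f x \<noteq> 0}" lborel] by auto
  then have "negligible {x. f x \<noteq> 0}"
    by (simp add: negligible_iff_null_sets null_sets_completionI)
  with op have "{x. f x \<noteq> 0} = {}"
    using open_not_negligible by blast
  then show ?thesis by auto
qed

section \<open>Energy and pair interaction of product functions\<close>

text \<open>The derivative in the direction \<open>axis i b\<close> differentiates only the factor at \<open>x $ i\<close>, so its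
  squared modulus is again a product of functions of one coordinate each.\<close>

lemma energy_tensor_power:
  fixes \<phi> :: "'a::euclidean_space \<Rightarrow> complex"
  assumes \<phi>: "Ck (Suc 0) \<phi>"
  shows "energy (\<lambda>b. pderiv_dir b (tensor_power \<phi> :: 'a ^ 'n::finite \<Rightarrow> complex))
    = of_nat CARD('n) * (energy (\<lambda>b. pderiv_dir b \<phi>) * (\<integral>\<^sup>+x. ennreal ((norm (\<phi> x))\<^sup>2) \<partial>lborel) ^ (CARD('n) - 1))"
proof -
  have d: "\<And>y. \<phi> differentiable (at y)" using \<phi> by simp
  have m\<phi> [measurable]: "\<phi> \<in> borel_measurable borel"
    by (intro borel_measurable_continuous_onI Ck_1_continuous \<phi>)
  have m [measurable]: "b \<in> Basis \<Longrightarrow> pderiv_dir b \<phi> \<in> borel_measurable borel" for b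
    using \<phi> by (intro borel_measurable_continuous_onI) auto
  let ?E = "\<lambda>b. \<integral>\<^sup>+x. ennreal ((norm (pderiv_dir b \<phi> x))\<^sup>2) \<partial>lborel"
  let ?m = "\<integral>\<^sup>+x. ennreal ((norm (\<phi> x))\<^sup>2) \<partial>lborel"
  have m' [measurable]: "pderiv_dir (axis i b) (tensor_power \<phi> :: 'a ^ 'n \<Rightarrow> complex) \<in> borel_measurable borel"
    if "b \<in> Basis" for i b
    using Ck_1_tensor_power[OF \<phi>] that by (intro borel_measurable_continuous_onI) auto
  have single: "(\<integral>\<^sup>+x. ennreal ((norm (pderiv_dir (axis i b) (tensor_power \<phi>) (x :: 'a ^ 'n)))\<^sup>2) \<partial>lborel)
      = ?E b * ?m ^ (CARD('n) - 1)" if b: "b \<in> Basis" for i b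
  proof -
    \<comment> \<open>the factor of the squared derivative that depends on coordinate \<open>k\<close>\<close>
    define f where "f k y = ennreal ((norm (if k = i then pderiv_dir b \<phi> y else \<phi> y))\<^sup>2)" for k :: 'n and y
    have [measurable]: "f k \<in> borel_measurable borel" for k
      unfolding f_def using b by (cases "k = i") simp_all
    have "ennreal ((norm (pderiv_dir (axis i b) (tensor_power \<phi>) x))\<^sup>2) = (\<Prod>k\<in>UNIV. f k (x $ k))" for x :: "'a ^ 'n"
    proof -
      have "(\<Prod>k\<in>UNIV. f k (x $ k)) = f i (x $ i) * (\<Prod>k\<in>UNIV - {i}. f k (x $ k))"
        by (simp add: prod.remove)
      also have "(\<Prod>k\<in>UNIV - {i}. f k (x $ k)) = (\<Prod>k\<in>UNIV - {i}. ennreal ((norm (\<phi> (x $ k)))\<^sup>2))"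
        by (intro prod.cong) (auto simp: f_def)
      finally show ?thesis
        by (simp add: f_def pderiv_dir_tensor_power[OF d] norm_mult power_mult_distrib prod_ennreal
            ennreal_mult' prod_norm[symmetric] prod_power_distrib)
    qed
    then have "(\<integral>\<^sup>+x. ennreal ((norm (pderiv_dir (axis i b) (tensor_power \<phi>) (x :: 'a ^ 'n)))\<^sup>2) \<partial>lborel)
        = (\<Prod>k\<in>UNIV. \<integral>\<^sup>+y. f k y \<partial>lborel)"
      by (simp add: nn_integral_vec_prod)
    also have "\<dots> = (\<integral>\<^sup>+y. f i y \<partial>lborel) * (\<Prod>k\<in>UNIV - {i}. \<integral>\<^sup>+y. f k y \<partial>lborel)"
      by (simp add: prod.remove)
    also have "(\<Prod>k\<in>UNIV - {i}. \<integral>\<^sup>+y. f k y \<partial>lborel) = (\<Prod>k\<in>UNIV - {i}. ?m)"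
      by (intro prod.cong) (auto simp: f_def)
    finally show ?thesis by (simp add: f_def card_Diff_subset)
  qed
  have E: "energy (\<lambda>b. pderiv_dir b \<phi>) = (\<Sum>b\<in>Basis. ?E b)"
    unfolding energy_def by (subst nn_integral_sum[symmetric]) (auto intro!: nn_integral_cong simp: sum_ennreal)
  have "energy (\<lambda>b. pderiv_dir b (tensor_power \<phi> :: 'a ^ 'n \<Rightarrow> complex))
      = (\<integral>\<^sup>+x. (\<Sum>i\<in>UNIV. \<Sum>b\<in>Basis. ennreal ((norm (pderiv_dir (axis i b) (tensor_power \<phi>) (x :: 'a ^ 'n)))\<^sup>2)) \<partial>lborel)"
    unfolding energy_def by (intro nn_integral_cong) (simp add: sum_Basis_vec sum_ennreal sum_nonneg)
  also have "\<dots> = (\<Sum>i\<in>(UNIV :: 'n set). \<Sum>b\<in>Basis. ?E b * ?m ^ (CARD('n) - 1))"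
    by (subst nn_integral_sum, simp, intro sum.cong refl, subst nn_integral_sum) (simp_all add: single)
  finally show ?thesis by (simp add: E sum_distrib_right)
qed

lemma two_card_ordered_pairs:
  "2 * card {(i :: 'n::{finite,linorder}, j). i < j} = CARD('n) * (CARD('n) - 1)"
proof -
  let ?L = "{(i :: 'n, j). i < j}"
  have swap: "card {(i :: 'n, j). j < i} = card ?L"
    by (rule bij_betw_same_card[where f = prod.swap], rule bij_betwI[where g = prod.swap]) auto
  have "CARD('n) * CARD('n) = card (UNIV :: ('n \<times> 'n) set)"
    by simp
  also have "(UNIV :: ('n \<times> 'n) set) = ?L \<union> {(i, j). j < i} \<union> (\<lambda>i. (i, i)) ` UNIV"
    by (auto simp: image_iff)
  also have "card \<dots> = card ?L + card {(i :: 'n, j). j < i} + CARD('n)"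
    by (subst card_Un_disjoint; (subst card_Un_disjoint)?) (auto simp: card_image inj_on_def)
  finally show ?thesis by (simp add: swap diff_mult_distrib2)
qed

lemma pair_hardy_sum_tensor_power:
  fixes \<phi> :: "real^'d \<Rightarrow> complex"
  assumes [measurable]: "\<phi> \<in> borel_measurable borel"
  shows "pair_hardy_sum (tensor_power \<phi> :: (real^'d, 'n::{finite,linorder}) vec \<Rightarrow> complex)
    = of_nat (card {(i :: 'n, j). i < j}) *
      (pair_integral \<phi> * (\<integral>\<^sup>+x. ennreal ((norm (\<phi> x))\<^sup>2) \<partial>lborel) ^ (CARD('n) - 2))"
proof -
  let ?m = "\<integral>\<^sup>+x. ennreal ((norm (\<phi> x))\<^sup>2) \<partial>lborel"
  define F where "F x y = ennreal ((norm (\<phi> x))\<^sup>2 * (norm (\<phi> y))\<^sup>2 / (norm (x - y))\<^sup>2)" for x y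
  have [measurable]: "case_prod F \<in> borel_measurable (borel \<Otimes>\<^sub>M borel)"
    unfolding F_def by measurable
  have "(\<integral>\<^sup>+x. ennreal ((norm (tensor_power \<phi> (x :: (real^'d, 'n) vec)))\<^sup>2 / (dist (x $ i) (x $ j))\<^sup>2) \<partial>lborel)
      = pair_integral \<phi> * ?m ^ (CARD('n) - 2)" if ij: "i < j" for i j
  proof -
    have "ennreal ((norm (tensor_power \<phi> x))\<^sup>2 / (dist (x $ i) (x $ j))\<^sup>2)
        = F (x $ i) (x $ j) * (\<Prod>k\<in>UNIV - {i, j}. ennreal ((norm (\<phi> (x $ k)))\<^sup>2))" for x :: "(real^'d, 'n) vec"
    proof -
      have "tensor_power \<phi> x = \<phi> (x $ i) * (\<phi> (x $ j) * (\<Prod>k\<in>UNIV - {i, j}. \<phi> (x $ k)))"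
        unfolding tensor_power_def using ij
        by (subst prod.remove[of _ i], simp, simp, subst prod.remove[of _ j]) (auto simp: Diff_insert2[symmetric] insert_commute)
      moreover have "(\<Prod>k\<in>UNIV - {i, j}. ennreal ((norm (\<phi> (x $ k)))\<^sup>2))
          = ennreal ((norm (\<Prod>k\<in>UNIV - {i, j}. \<phi> (x $ k)))\<^sup>2)"
        by (simp add: prod_ennreal prod_norm[symmetric] prod_power_distrib)
      ultimately show ?thesis
        by (simp add: F_def dist_norm norm_mult power_mult_distrib ennreal_mult'[symmetric])
    qed
    then show ?thesis
      using ij nn_integral_vec_pair[of i j F "\<lambda>y. ennreal ((norm (\<phi> y))\<^sup>2)"]
      by (simp add: pair_integral_def F_def[symmetric])
  qed
  then have "pair_hardy_sum (tensor_power \<phi> :: (real^'d, 'n) vec \<Rightarrow> complex)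
      = (\<Sum>p\<in>{(i :: 'n, j). i < j}. pair_integral \<phi> * ?m ^ (CARD('n) - 2))"
    unfolding pair_hardy_sum_def by (intro sum.cong) auto
  then show ?thesis by simp
qed

section \<open>Comparison of the two infima\<close>

text \<open>No condition on \<open>E\<close> or \<open>M\<close> is needed: both sides agree also when \<open>M\<close> is \<open>0\<close> or \<open>\<infinity>\<close>, by the
  conventions for division in \<^typ>\<open>ennreal\<close>.\<close>

lemma quotient_identity:
  fixes E m M :: ennreal
  assumes m: "m \<noteq> 0" "m \<noteq> \<infinity>" and N: "2 \<le> N" and p: "2 * p = N * (N - 1)"
  shows "of_nat N * (E * m ^ (N - 1)) / (of_nat p * (M * m ^ (N - 2))) = 2 * (E * m / M) / of_nat (N - 1)"
proof -
  have mp: "m ^ (N - 2) \<noteq> 0" "m ^ (N - 2) \<noteq> \<infinity>"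
    using m by (auto simp: power_eq_top_ennreal)
  have "N - 1 = Suc (N - 2)" using N by simp
  then have "of_nat N * (E * m ^ (N - 1)) / (of_nat p * (M * m ^ (N - 2)))
      = (of_nat N * (E * m) * m ^ (N - 2)) / (of_nat p * M * m ^ (N - 2))"
    by (simp add: mult_ac)
  also have "\<dots> = of_nat N * (E * m) / (of_nat p * M)"
    using mp by (rule divide_mult_eq)
  also have "\<dots> = (2 * (E * m) * of_nat N) / (of_nat (2 * p) * M)"
    using divide_mult_eq[of 2 "of_nat N * (E * m)" "of_nat p * M"] by (simp add: mult_ac)
  also have "\<dots> = 2 * (E * m) / (of_nat (N - 1) * M)"
    using divide_mult_eq[of "of_nat N" "2 * (E * m)" "of_nat (N - 1) * M"] N
    by (simp only: p of_nat_mult) (simp add: mult_ac)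
  also have "\<dots> = 2 * (E * m / M) / of_nat (N - 1)"
  proof -
    have "inverse (of_nat (N - 1) * M) = inverse (of_nat (N - 1)) * inverse M"
      using N by (intro ennreal_inverse_mult') (auto simp: zero_less_iff_neq_zero less_top[symmetric])
    then show ?thesis by (simp add: divide_ennreal_def mult_ac)
  qed
  finally show ?thesis .
qed

lemma le_cmult_INF_ennreal:
  fixes k h :: ennreal
  assumes k: "k \<noteq> 0" "k \<noteq> \<infinity>" and le: "\<And>x. x \<in> A \<Longrightarrow> h \<le> k * f x"
  shows "h \<le> k * (INF x\<in>A. f x)"
proof -
  have inv: "inverse k * k = 1"
    using k ennreal_divide_self[of k] by (simp add: divide_ennreal_def mult.commute less_top)
  have "inverse k * h \<le> (INF x\<in>A. f x)"
  proof (rule INF_greatest)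
    fix x assume "x \<in> A"
    then have "inverse k * h \<le> inverse k * (k * f x)"
      by (intro mult_left_mono le) auto
    then show "inverse k * h \<le> f x"
      by (simp add: mult.assoc[symmetric] inv)
  qed
  then have "k * (inverse k * h) \<le> k * (INF x\<in>A. f x)"
    by (rule mult_left_mono) simp
  then show ?thesis
    by (simp add: mult.assoc[symmetric] mult.commute[of k] inv)
qed

theorem theorem2p3:
  assumes "CARD('d::finite) \<ge> 3" and "CARD('n::{finite,linorder}) \<ge> 2"
  shows "hardy_const TYPE('d) TYPE('n) \<le> 2 * D_const TYPE('d) / of_nat (CARD('n) - 1)"
proof -
  let ?c = "of_nat (CARD('n) - 1) :: ennreal"
  have key: "hardy_const TYPE('d) TYPE('n) \<le>
      2 * (energy (\<lambda>b. pderiv_dir b \<phi>) * (\<integral>\<^sup>+x. ennreal ((norm (\<phi> x))\<^sup>2) \<partial>lborel) / pair_integral \<phi>) / ?c"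
    if t: "\<phi> \<in> test_functions" and nz: "\<phi> \<noteq> (\<lambda>_. 0)" for \<phi> :: "real^'d \<Rightarrow> complex"
  proof -
    let ?m = "\<integral>\<^sup>+x. ennreal ((norm (\<phi> x))\<^sup>2) \<partial>lborel"
    let ?u = "tensor_power \<phi> :: (real^'d, 'n) vec \<Rightarrow> complex"
    have \<phi>: "Ck (Suc 0) \<phi>" and cpt: "compact (closure {x. \<phi> x \<noteq> 0})"
      using t unfolding test_functions_def by blast+
    have cont: "continuous_on UNIV \<phi>" by (rule Ck_1_continuous[OF \<phi>])
    then have [measurable]: "\<phi> \<in> borel_measurable borel" by (rule borel_measurable_continuous_onI)
    obtain R where "\<forall>x\<in>closure {x. \<phi> x \<noteq> 0}. norm x \<le> R"
      using compact_imp_bounded[OF cpt] unfolding bounded_iff by blast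
    then have R: "\<phi> x = 0" if "R < norm x" for x
      using that closure_subset[of "{x. \<phi> x \<noteq> 0}"] by force
    have u1: "Ck (Suc 0) ?u" by (rule Ck_1_tensor_power[OF \<phi>])
    have "\<phi> \<in> L2" by (rule L2_continuous_bounded_support[OF cont R])
    then have m_fin: "?m \<noteq> \<infinity>" by (simp add: L2_def less_top)
    have m_nz: "?m \<noteq> 0"
    proof
      assume "?m = 0"
      then have "AE x in lborel. \<phi> x = 0"
        by (subst (asm) nn_integral_0_iff_AE) auto
      with nz cont show False using continuous_AE_lborel_eq_0 by blast
    qed
    obtain a where a: "\<phi> a \<noteq> 0" using nz by auto
    have "?u (vec_lambda (\<lambda>_. a)) \<noteq> 0" by (simp add: tensor_power_def a)
    then have u_nz: "\<not> (AE x in lborel. ?u x = 0)"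
      using continuous_AE_lborel_eq_0[OF Ck_1_continuous[OF u1]] by metis
    have wg: "weak_gradient ?u (\<lambda>b. pderiv_dir b ?u)"
      using u1 tensor_power_bounded_support[OF R] by (rule weak_gradient_pderiv_dir)
    have "?u \<in> L2"
      using Ck_1_continuous[OF u1] tensor_power_bounded_support[OF R] by (rule L2_continuous_bounded_support)
    with wg have "?u \<in> H1" by (auto simp: H1_def)
    then have "hardy_const TYPE('d) TYPE('n) \<le> energy (\<lambda>b. pderiv_dir b ?u) / pair_hardy_sum ?u"
      unfolding hardy_const_def using wg u_nz
      by (intro INF_lower2[where i = "(?u, \<lambda>b. pderiv_dir b ?u)"]) auto
    also have "\<dots> = 2 * (energy (\<lambda>b. pderiv_dir b \<phi>) * ?m / pair_integral \<phi>) / ?c"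
      unfolding energy_tensor_power[OF \<phi>] pair_hardy_sum_tensor_power[OF \<open>\<phi> \<in> borel_measurable borel\<close>]
      by (rule quotient_identity[OF m_nz m_fin assms(2) two_card_ordered_pairs])
    finally show ?thesis .
  qed
  have c: "?c \<noteq> 0" "?c \<noteq> \<infinity>" using assms(2) by auto
  have "hardy_const TYPE('d) TYPE('n) \<le> 2 / ?c * D_const TYPE('d)"
    unfolding D_const_def
  proof (rule le_cmult_INF_ennreal)
    show "2 / ?c \<noteq> 0" "2 / ?c \<noteq> \<infinity>"
      using c by (auto simp: ennreal_divide_eq_top_iff)
  qed (use key in \<open>auto simp: divide_ennreal_def mult_ac\<close>)
  then show ?thesis by (simp add: divide_ennreal_def mult_ac)
qed

end
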